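(* Up to collinearity there are exactly 7 generalised nice sets $T\subseteq X_0$ such that $T\cap X$ is not a generalised nice set: every such $T$ is collinear to exactly one of the following sets: (1) $\{\{0,0\}\}\cup\{\{0,l\},\{1,l\}: l\in\{1,2,5\}\}$ (7 elements); (2) $\{\{0,0\}\}\cup\{\{0,l\},\{1,l\}: l\in\{1,2,5\}\}\cup\{\{2,2\},\{2,5\},\{5,5\}\}$ (10 elements); (3) $\{\{0,0\}\}\cup\{\{0,l\},\{1,l\}: l\in\{1,2,5\}\}\cup\{\{0,3\},\{0,6\},\{1,3\},\{1,6\}\}$ (11 elements); (4) $\{\{0,0\}\}\cup\{\{0,l\},\{1,l\}: l=1,\dots,7\}$ (15 elements); (5) $\{\{0,0\}\}\cup\{\{0,l\},\{1,l\}: l=1,\dots,7\}\cup\{\{2,3\},\{5,3\},\{2,6\},\{5,6\}\}$ (19 elements); (6) $X_0\setminus\{\{k,l\}: k,l\in\{3,4,6,7\}\}$, where $k=l$ is allowed (26 elements); (7) $X_0$ (36 elements).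
   Context: Let $I=\{1,\dots,7\}$ and $I_0=I\cup\{0\}$. The Fano plane on $I$ has the seven lines $\{1,2,5\},\{5,6,7\},\{1,4,7\},\{1,3,6\},\{2,4,6\},\{2,3,7\},\{3,4,5\}$. For distinct $i,j\in I$, $i*j$ is the third point of the unique line containing $i$ and $j$. The operation is extended to $I_0$ by $0*i=i*0=i$ and $i*i=0$ for all $i\in I_0$. A collineation is a bijection $\sigma:I_0\to I_0$ with $\sigma(i*j)=\sigma(i)*\sigma(j)$ for all $i,j\in I_0$. Let $X_0$ be the set of unordered pairs $\{i,j\}$ with $i,j\in I_0$, where $i=j$ is allowed, and $X=\{\{i,j\}:i,j\in I,\ i\neq j\}$. A collineation $\sigma$ acts on $X_0$ by $\tilde\sigma(\{i,j\})=\{\sigma(i),\sigma(j)\}$, hence on subsets; subsets $T,T'\subseteq X_0$ are collinear if $\tilde\sigma(T)=T'$ for some collineation $\sigma$. For $i,j,k\in I_0$ let $P_{\{i,j,k\}}=\{\{i,j\},\{j,k\},\{k,i\},\{i,j*k\},\{j,k*i\},\{k,i*j\}\}\subseteq X_0$. A subset $T\subseteq X_0$ is a generalised nice set if for all $i,j,k\in I_0$, $\{i,j\}\in T$ and $\{i*j,k\}\in T$ imply $P_{\{i,j,k\}}\subseteq T$. *)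

theory Defs
  imports Main
begin

definition fano_points :: "nat set" where
  "fano_points = {1..7}"

definition fano_points0 :: "nat set" where
  "fano_points0 = insert 0 fano_points"

definition fano_lines :: "nat set set" where
  "fano_lines = {{1,2,5}, {5,6,7}, {1,4,7}, {1,3,6}, {2,4,6}, {2,3,7}, {3,4,5}}"

(* Lines have three elements, so for distinct i and j a point k with {i, j, k} a line is
   automatically different from both. Values outside {0..7} are irrelevant. *)
definition fano_op :: "nat \<Rightarrow> nat \<Rightarrow> nat" (infixl "\<star>" 70) where
  "i \<star> j = (if i = 0 then j else if j = 0 then i else if i = j then 0
            else (THE k. {i, j, k} \<in> fano_lines))"

definition collineation :: "(nat \<Rightarrow> nat) \<Rightarrow> bool" where
  "collineation \<sigma> \<longleftrightarrow> bij_betw \<sigma> fano_points0 fano_points0 \<and>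
     (\<forall>i\<in>fano_points0. \<forall>j\<in>fano_points0. \<sigma> (i \<star> j) = \<sigma> i \<star> \<sigma> j)"

(* An unordered pair is the set {i, j}; the degenerate pair {i, i} is the singleton {i}. *)
definition pairs0 :: "nat set set" where
  "pairs0 = {{i, j} | i j. i \<in> fano_points0 \<and> j \<in> fano_points0}"

definition pairs :: "nat set set" where
  "pairs = {{i, j} | i j. i \<in> fano_points \<and> j \<in> fano_points \<and> i \<noteq> j}"

definition pair_action :: "(nat \<Rightarrow> nat) \<Rightarrow> nat set \<Rightarrow> nat set" where
  "pair_action \<sigma> p = \<sigma> ` p"

definition collinear_sets :: "nat set set \<Rightarrow> nat set set \<Rightarrow> bool" where
  "collinear_sets T T' \<longleftrightarrow> T \<subseteq> pairs0 \<and> T' \<subseteq> pairs0 \<and>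
     (\<exists>\<sigma>. collineation \<sigma> \<and> pair_action \<sigma> ` T = T')"

definition P_set :: "nat \<Rightarrow> nat \<Rightarrow> nat \<Rightarrow> nat set set" where
  "P_set i j k = {{i, j}, {j, k}, {k, i}, {i, j \<star> k}, {j, k \<star> i}, {k, i \<star> j}}"

definition gen_nice :: "nat set set \<Rightarrow> bool" where
  "gen_nice T \<longleftrightarrow> T \<subseteq> pairs0 \<and>
     (\<forall>i\<in>fano_points0. \<forall>j\<in>fano_points0. \<forall>k\<in>fano_points0.
        {i, j} \<in> T \<and> {i \<star> j, k} \<in> T \<longrightarrow> P_set i j k \<subseteq> T)"

definition nice_reps :: "nat set set list" where
  "nice_reps =
    [{{0, 0}} \<union> (\<Union>l\<in>{1,2,5}. {{0, l}, {1, l}}),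
     {{0, 0}} \<union> (\<Union>l\<in>{1,2,5}. {{0, l}, {1, l}}) \<union> {{2, 2}, {2, 5}, {5, 5}},
     {{0, 0}} \<union> (\<Union>l\<in>{1,2,5}. {{0, l}, {1, l}}) \<union> {{0, 3}, {0, 6}, {1, 3}, {1, 6}},
     {{0, 0}} \<union> (\<Union>l\<in>{1..7}. {{0, l}, {1, l}}),
     {{0, 0}} \<union> (\<Union>l\<in>{1..7}. {{0, l}, {1, l}}) \<union> {{2, 3}, {5, 3}, {2, 6}, {5, 6}},
     pairs0 - {{k, l} | k l. k \<in> {3,4,6,7} \<and> l \<in> {3,4,6,7}},
     pairs0]"

end

theory Submission
  imports Defs
begin

text \<open>
  Under \<open>\<star>\<close> the set \<open>I\<^sub>0\<close> is an elementary abelian group of order 8 and the collineations are its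
  automorphisms. If \<open>T\<close> is generalised nice and \<open>T \<inter> X\<close> is not, the failure can only come from
  \<open>{i, j}, {i, i \<star> j} \<in> T\<close> with \<open>i \<noteq> j\<close> in \<open>I\<close>, and a collineation moves \<open>(i, j)\<close> to \<open>(1, 2)\<close>.
  Let \<open>A = {k. {0, k} \<in> T}\<close>, which contains \<open>0, 1, 2, 5\<close>. Every pair in \<open>T\<close> has both entries in \<open>A\<close>,
  and \<open>T\<close> is invariant under adding 1 to either entry. So \<open>T\<close> comes from a
  symmetric relation on the quotient by \<open>{0, 1}\<close>, a Klein four-group with nonzero classes
  represented by \<open>2, 3, 4\<close>. If \<open>3\<close> and \<open>4\<close> both lie in \<open>A\<close>, then there a loop at a nonzero
  class is present iff both edges from it to the other two nonzero classes are. If exactly one of them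
  does, no two nonzero classes are related; if neither does, a loop at the class of 2 is the only
  possibility. This leaves twelve relations, which the collineations permuting the
  classes reduce to the seven representatives; these are told apart by their cardinalities.
\<close>

declare One_nat_def [simp del]

section \<open>The points with 0 as an elementary abelian group\<close>

lemma fano_points0_eq: "fano_points0 = {0,1,2,3,4,5,6,7}"
  by (auto simp: fano_points0_def fano_points_def)

lemma fano_points0_mem [simp]:
  "0 \<in> fano_points0" "1 \<in> fano_points0" "2 \<in> fano_points0" "3 \<in> fano_points0"
  "4 \<in> fano_points0" "5 \<in> fano_points0" "6 \<in> fano_points0" "7 \<in> fano_points0"
  by (simp_all add: fano_points0_eq)

lemma fano_points_iff: "i \<in> fano_points \<longleftrightarrow> i \<in> fano_points0 \<and> i \<noteq> 0"
  by (auto simp: fano_points0_def fano_points_def)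

lemma fano_op_0 [simp]: "0 \<star> j = j" "i \<star> 0 = i" "i \<star> i = 0"
  by (auto simp: fano_op_def)

text \<open>Two lines through \<open>i\<close> and \<open>j\<close> share two points, hence
  coincide, and a three-point line determines its third point. So the \<open>THE\<close> in the
  definition is well defined.\<close>

lemma fano_op_line:
  assumes "{i, j, k} \<in> fano_lines" "i \<noteq> j"
  shows "i \<star> j = k"
proof -
  have card3: "card L = 3 \<and> 0 \<notin> L" if "L \<in> fano_lines" for L
    using that by (auto simp: fano_lines_def)
  have meet: "\<forall>L\<in>fano_lines. \<forall>M\<in>fano_lines. L = M \<or> card (L \<inter> M) = 1"
    by (simp add: fano_lines_def)
  have "k' = k" if k': "{i, j, k'} \<in> fano_lines" for k'
  proof -
    have "card ({i, j, k} \<inter> {i, j, k'}) \<ge> card {i, j}"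
      by (rule card_mono) auto
    then have "{i, j, k} = {i, j, k'}"
      using meet assms k' by fastforce
    then show ?thesis
      using card3 [OF assms(1)] card3 [OF k'] by (auto simp: card_insert_if split: if_splits)
  qed
  then have "(THE k. {i, j, k} \<in> fano_lines) = k"
    using assms(1) by (intro the_equality)
  then show ?thesis
    using assms card3 [OF assms(1)] by (auto simp: fano_op_def)
qed

text \<open>All 42 sums of distinct nonzero points. The literal \<open>1\<close> is matched because
  \<open>One_nat_def\<close> has been removed from the simp set.\<close>

lemma fano_op_table [simp]:
  "1 \<star> 2 = 5" "1 \<star> 3 = 6" "1 \<star> 4 = 7" "1 \<star> 5 = 2" "1 \<star> 6 = 3" "1 \<star> 7 = 4"
  "2 \<star> 1 = 5" "2 \<star> 3 = 7" "2 \<star> 4 = 6" "2 \<star> 5 = 1" "2 \<star> 6 = 4" "2 \<star> 7 = 3"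
  "3 \<star> 1 = 6" "3 \<star> 2 = 7" "3 \<star> 4 = 5" "3 \<star> 5 = 4" "3 \<star> 6 = 1" "3 \<star> 7 = 2"
  "4 \<star> 1 = 7" "4 \<star> 2 = 6" "4 \<star> 3 = 5" "4 \<star> 5 = 3" "4 \<star> 6 = 2" "4 \<star> 7 = 1"
  "5 \<star> 1 = 2" "5 \<star> 2 = 1" "5 \<star> 3 = 4" "5 \<star> 4 = 3" "5 \<star> 6 = 7" "5 \<star> 7 = 6"
  "6 \<star> 1 = 3" "6 \<star> 2 = 4" "6 \<star> 3 = 1" "6 \<star> 4 = 2" "6 \<star> 5 = 7" "6 \<star> 7 = 5"
  "7 \<star> 1 = 4" "7 \<star> 2 = 3" "7 \<star> 3 = 2" "7 \<star> 4 = 1" "7 \<star> 5 = 6" "7 \<star> 6 = 5"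
  by (rule fano_op_line; simp add: fano_lines_def insert_commute)+

lemma fano_op_closed [simp]:
  "i \<in> fano_points0 \<Longrightarrow> j \<in> fano_points0 \<Longrightarrow> i \<star> j \<in> fano_points0"
  by (simp add: fano_points0_eq; elim disjE; simp)

lemma fano_op_commute: "i \<star> j = j \<star> i"
  by (simp add: fano_op_def insert_commute)

text \<open>A finite check of 512 triples. With it, \<open>fano_points0\<close> is a vector space of
  dimension 3 over the field of two elements, with \<open>\<star>\<close> as addition.\<close>

lemma fano_op_assoc:
  assumes "i \<in> fano_points0" "j \<in> fano_points0" "k \<in> fano_points0"
  shows "(i \<star> j) \<star> k = i \<star> (j \<star> k)"
proof -
  have "\<forall>i\<in>fano_points0. \<forall>j\<in>fano_points0. \<forall>k\<in>fano_points0. (i \<star> j) \<star> k = i \<star> (j \<star> k)"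
    by (simp add: fano_points0_eq)
  then show ?thesis using assms by blast
qed

lemma fano_op_left_commute:
  assumes "i \<in> fano_points0" "j \<in> fano_points0" "k \<in> fano_points0"
  shows "i \<star> (j \<star> k) = j \<star> (i \<star> k)"
  using assms by (metis fano_op_assoc fano_op_commute)

lemma fano_op_cancel:
  assumes "i \<in> fano_points0" "j \<in> fano_points0"
  shows "i \<star> (i \<star> j) = j"
  using fano_op_assoc [of i i j] assms by simp

section \<open>Unordered pairs\<close>

lemma pair_mem_pairs0 [simp]: "{i, j} \<in> pairs0 \<longleftrightarrow> i \<in> fano_points0 \<and> j \<in> fano_points0"
  unfolding pairs0_def by (auto simp: doubleton_eq_iff)

lemma singleton_mem_pairs0 [simp]: "{i} \<in> pairs0 \<longleftrightarrow> i \<in> fano_points0"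
  using pair_mem_pairs0 [of i i] by simp

lemma pair_mem_pairs [simp]:
  "{i, j} \<in> pairs \<longleftrightarrow> i \<in> fano_points \<and> j \<in> fano_points \<and> i \<noteq> j"
  unfolding pairs_def by (auto simp: doubleton_eq_iff)

lemma pairs0_cases:
  assumes "p \<in> pairs0"
  obtains i j where "p = {i, j}" "i \<in> fano_points0" "j \<in> fano_points0"
  using assms unfolding pairs0_def by blast

lemma pairs0_eqI:
  assumes "T \<subseteq> pairs0" "R \<subseteq> pairs0"
    and "\<And>i j. i \<in> fano_points0 \<Longrightarrow> j \<in> fano_points0 \<Longrightarrow> {i, j} \<in> T \<longleftrightarrow> {i, j} \<in> R"
  shows "T = R"
proof -
  have "p \<in> T \<longleftrightarrow> p \<in> R" if "p \<in> pairs0" for p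
    using that assms(3) by (auto elim: pairs0_cases)
  with assms(1,2) show ?thesis by blast
qed

section \<open>Collineations and collinear sets\<close>

lemma collineation_id: "collineation id"
  by (simp add: collineation_def)

lemma collineation_comp:
  assumes "collineation \<sigma>" "collineation \<tau>"
  shows "collineation (\<tau> \<circ> \<sigma>)"
proof -
  have "bij_betw (\<tau> \<circ> \<sigma>) fano_points0 fano_points0"
    using assms unfolding collineation_def by (blast intro: bij_betw_trans)
  moreover have "\<sigma> i \<in> fano_points0" if "i \<in> fano_points0" for i
    using assms(1) that bij_betwE unfolding collineation_def by blast
  ultimately show ?thesis
    using assms by (simp add: collineation_def)
qed

lemma collineation_inv_into:
  assumes "collineation \<sigma>"
  shows "collineation (inv_into fano_points0 \<sigma>)"
proof -
  let ?\<tau> = "inv_into fano_points0 \<sigma>"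
  have \<sigma>: "bij_betw \<sigma> fano_points0 fano_points0"
    using assms by (simp add: collineation_def)
  have \<tau>: "bij_betw ?\<tau> fano_points0 fano_points0"
    using \<sigma> by (rule bij_betw_inv_into)
  have "?\<tau> (i \<star> j) = ?\<tau> i \<star> ?\<tau> j" if "i \<in> fano_points0" "j \<in> fano_points0" for i j
  proof -
    have mem: "?\<tau> i \<in> fano_points0" "?\<tau> j \<in> fano_points0"
      using \<tau> that by (auto dest: bij_betwE)
    have "\<sigma> (?\<tau> i \<star> ?\<tau> j) = i \<star> j"
      using assms mem that bij_betw_inv_into_right [OF \<sigma>] by (simp add: collineation_def)
    then show ?thesis
      using bij_betw_inv_into_left [OF \<sigma>] mem by (metis fano_op_closed)
  qed
  with \<tau> show ?thesis
    by (simp add: collineation_def)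
qed

lemma collinear_sets_refl: "T \<subseteq> pairs0 \<Longrightarrow> collinear_sets T T"
  unfolding collinear_sets_def pair_action_def
  using collineation_id by (intro conjI exI [of _ id]) simp_all

lemma collinear_sets_trans:
  assumes "collinear_sets S T" "collinear_sets T U"
  shows "collinear_sets S U"
proof -
  obtain \<sigma> \<tau> where "collineation \<sigma>" "pair_action \<sigma> ` S = T" "collineation \<tau>" "pair_action \<tau> ` T = U"
    using assms by (auto simp: collinear_sets_def)
  then have "collineation (\<tau> \<circ> \<sigma>)" "pair_action (\<tau> \<circ> \<sigma>) ` S = U"
    by (auto simp: collineation_comp pair_action_def image_comp)
  with assms show ?thesis
    by (auto simp: collinear_sets_def)
qed

lemma collinear_sets_sym:
  assumes "collinear_sets T U"
  shows "collinear_sets U T"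
proof -
  obtain \<sigma> where \<sigma>: "collineation \<sigma>" "pair_action \<sigma> ` T = U" "T \<subseteq> pairs0" "U \<subseteq> pairs0"
    using assms by (auto simp: collinear_sets_def)
  \<comment> \<open>A pair has both entries in \<open>fano_points0\<close>, where
    \<open>\<sigma>\<close> is injective, so \<open>inv_into\<close> undoes the action on
    it.\<close>
  have "pair_action (inv_into fano_points0 \<sigma>) (pair_action \<sigma> p) = p" if "p \<in> T" for p
  proof -
    have "p \<subseteq> fano_points0"
      using that \<sigma>(3) by (auto simp: pairs0_def)
    moreover have "inj_on \<sigma> fano_points0"
      using \<sigma>(1) by (simp add: collineation_def bij_betw_def)
    ultimately show ?thesis
      by (simp add: pair_action_def inv_into_image_cancel)
  qed
  then have "pair_action (inv_into fano_points0 \<sigma>) ` U = T"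
    using \<sigma>(2) by (auto simp: image_iff)
  with \<sigma>(3,4) collineation_inv_into [OF \<sigma>(1)] show ?thesis
    unfolding collinear_sets_def by auto
qed

text \<open>Taking images is injective on subsets of \<open>fano_points0\<close>. Cardinality is the
  invariant that later separates the representatives.\<close>

lemma collinear_sets_card:
  assumes "collinear_sets T U"
  shows "card T = card U"
proof -
  obtain \<sigma> where \<sigma>: "collineation \<sigma>" "pair_action \<sigma> ` T = U" "T \<subseteq> pairs0"
    using assms by (auto simp: collinear_sets_def)
  have "inj_on (image \<sigma>) (Pow fano_points0)"
    using \<sigma>(1) by (simp add: collineation_def bij_betw_def inj_on_image_Pow)
  moreover have "T \<subseteq> Pow fano_points0"
    using \<sigma>(3) by (auto simp: pairs0_def)
  moreover have "pair_action \<sigma> = image \<sigma>"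
    by (simp add: fun_eq_iff pair_action_def)
  ultimately have "inj_on (pair_action \<sigma>) T"
    by (metis inj_on_subset)
  then show ?thesis
    using \<sigma>(2) by (auto simp: card_image)
qed

text \<open>Preimage rather than image: membership of \<open>{i, j}\<close> becomes membership of
  \<open>{\<sigma> i, \<sigma> j}\<close> in \<open>T\<close>, with no inverse to compute.\<close>

definition pullback :: "(nat \<Rightarrow> nat) \<Rightarrow> nat set set \<Rightarrow> nat set set" where
  "pullback \<sigma> T = {p \<in> pairs0. \<sigma> ` p \<in> T}"

lemma pair_mem_pullback [simp]:
  "{i, j} \<in> pullback \<sigma> T \<longleftrightarrow> i \<in> fano_points0 \<and> j \<in> fano_points0 \<and> {\<sigma> i, \<sigma> j} \<in> T"
  by (auto simp: pullback_def)

lemma singleton_mem_pullback [simp]: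
  "{i} \<in> pullback \<sigma> T \<longleftrightarrow> i \<in> fano_points0 \<and> {\<sigma> i} \<in> T"
  by (auto simp: pullback_def)

lemma collinear_pullback:
  assumes "collineation \<sigma>" "T \<subseteq> pairs0"
  shows "collinear_sets T (pullback \<sigma> T)"
proof (rule collinear_sets_sym)
  have surj: "\<sigma> ` fano_points0 = fano_points0"
    using assms(1) by (simp add: collineation_def bij_betw_def)
  have "q \<in> pair_action \<sigma> ` pullback \<sigma> T" if q: "q \<in> T" for q
  proof -
    obtain i j where ij: "q = {i, j}" "i \<in> fano_points0" "j \<in> fano_points0"
      using q assms(2) by (blast elim: pairs0_cases)
    then obtain i' j' where "i = \<sigma> i'" "i' \<in> fano_points0" "j = \<sigma> j'" "j' \<in> fano_points0"
      using surj by blast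
    then have "q = pair_action \<sigma> {i', j'}" "{i', j'} \<in> pullback \<sigma> T"
      using ij q by (auto simp: pair_action_def)
    then show ?thesis by blast
  qed
  then have "pair_action \<sigma> ` pullback \<sigma> T = T"
    by (auto simp: pullback_def pair_action_def)
  then show "collinear_sets (pullback \<sigma> T) T"
    using assms unfolding collinear_sets_def by (auto simp: pullback_def)
qed

section \<open>Generalised nice sets under collineations\<close>

lemma gen_niceD:
  assumes "gen_nice T" "{i, j} \<in> T" "{i \<star> j, k} \<in> T"
    and "i \<in> fano_points0" "j \<in> fano_points0" "k \<in> fano_points0"
  shows "{j, k} \<in> T" "{k, i} \<in> T" "{i, j \<star> k} \<in> T" "{j, k \<star> i} \<in> T" "{k, i \<star> j} \<in> T"
proof -
  have "P_set i j k \<subseteq> T"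
    using assms by (simp add: gen_nice_def)
  then show "{j, k} \<in> T" "{k, i} \<in> T" "{i, j \<star> k} \<in> T" "{j, k \<star> i} \<in> T" "{k, i \<star> j} \<in> T"
    by (simp_all add: P_set_def)
qed

text \<open>Since \<open>\<sigma>\<close> respects \<open>\<star>\<close>, it carries the pairs of
  \<open>P_set i j k\<close> to those of
  \<open>P_set (\<sigma> i) (\<sigma> j) (\<sigma> k)\<close>.\<close>

lemma gen_nice_pullback:
  assumes "collineation \<sigma>" "gen_nice T"
  shows "gen_nice (pullback \<sigma> T)"
proof -
  have \<sigma>: "\<sigma> i \<in> fano_points0" "\<sigma> (i \<star> j) = \<sigma> i \<star> \<sigma> j"
    if "i \<in> fano_points0" "j \<in> fano_points0" for i j
    using assms(1) that by (auto simp: collineation_def dest: bij_betwE)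
  show ?thesis
    unfolding gen_nice_def
  proof (intro conjI ballI impI)
    show "pullback \<sigma> T \<subseteq> pairs0"
      by (auto simp: pullback_def)
  next
    fix i j k
    assume ijk: "i \<in> fano_points0" "j \<in> fano_points0" "k \<in> fano_points0"
      and "{i, j} \<in> pullback \<sigma> T \<and> {i \<star> j, k} \<in> pullback \<sigma> T"
    then show "P_set i j k \<subseteq> pullback \<sigma> T"
      using gen_niceD [OF assms(2), of "\<sigma> i" "\<sigma> j" "\<sigma> k"] by (simp add: P_set_def \<sigma>)
  qed
qed

text \<open>The collineation sending the basis \<open>1, 2, 3\<close> to \<open>u, v, w\<close>; note \<open>4 = 1 \<star> (2 \<star> 3)\<close>.\<close>
definition basis_map :: "nat \<Rightarrow> nat \<Rightarrow> nat \<Rightarrow> nat \<Rightarrow> nat" where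
  "basis_map u v w x = [0, u, v, w, u \<star> (v \<star> w), u \<star> v, u \<star> w, v \<star> w] ! x"

lemma basis_map_simps [simp]:
  "basis_map u v w 0 = 0" "basis_map u v w 1 = u" "basis_map u v w 2 = v"
  "basis_map u v w 3 = w" "basis_map u v w 4 = u \<star> (v \<star> w)" "basis_map u v w 5 = u \<star> v"
  "basis_map u v w 6 = u \<star> w" "basis_map u v w 7 = v \<star> w"
  by (simp_all add: basis_map_def)

lemma fano_op_eq_0_iff:
  assumes "i \<in> fano_points0" "j \<in> fano_points0"
  shows "i \<star> j = 0 \<longleftrightarrow> i = j"
  using fano_op_cancel [OF assms] by (metis fano_op_0(2,3))

text \<open>The vectors \<open>u\<close>, \<open>v\<close>, \<open>w\<close> are linearly
  independent, and the values at the nonzero points are their seven nonempty sums. So the map is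
  linear with trivial kernel, hence injective, and bijective by finiteness.\<close>

lemma collineation_basis_map:
  assumes I0: "u \<in> fano_points0" "v \<in> fano_points0" "w \<in> fano_points0"
    and indep: "u \<noteq> 0" "v \<noteq> 0" "u \<noteq> v" "w \<notin> {0, u, v, u \<star> v}"
  shows "collineation (basis_map u v w)"
proof -
  let ?\<phi> = "basis_map u v w"
  have closed: "?\<phi> i \<in> fano_points0" if "i \<in> fano_points0" for i
    using that I0 by (auto simp: fano_points0_eq [THEN eqset_imp_iff, of i])
  have "\<forall>i\<in>fano_points0. \<forall>j\<in>fano_points0. ?\<phi> (i \<star> j) = ?\<phi> i \<star> ?\<phi> j"
    unfolding fano_points0_eq
    using I0 by (simp add: fano_op_assoc fano_op_commute fano_op_left_commute fano_op_cancel)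
  then have hom: "?\<phi> (i \<star> j) = ?\<phi> i \<star> ?\<phi> j" if "i \<in> fano_points0" "j \<in> fano_points0" for i j
    using that by blast
  have sums: "u \<star> (v \<star> w) = (u \<star> v) \<star> w"
    using I0 by (simp add: fano_op_assoc)
  have kernel: "i = 0" if "?\<phi> i = 0" "i \<in> fano_points0" for i
    using that indep I0 by (auto simp: fano_points0_eq [THEN eqset_imp_iff, of i] sums fano_op_eq_0_iff)
  have "inj_on ?\<phi> fano_points0"
    by (rule inj_onI) (metis closed hom kernel fano_op_closed fano_op_eq_0_iff)
  moreover have "?\<phi> ` fano_points0 \<subseteq> fano_points0"
    using closed by blast
  moreover have "finite fano_points0"
    by (simp add: fano_points0_eq)
  ultimately have "bij_betw ?\<phi> fano_points0 fano_points0"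
    by (simp add: bij_betw_def endo_inj_surj)
  with hom show ?thesis
    by (simp add: collineation_def)
qed

section \<open>The witness of failure and its normal form\<close>

lemma not_nice_witness:
  assumes "gen_nice T" "\<not> gen_nice (T \<inter> pairs)"
  obtains i j where "i \<in> fano_points" "j \<in> fano_points" "i \<noteq> j" "{i, j} \<in> T" "{i, i \<star> j} \<in> T"
proof -
  have "T \<inter> pairs \<subseteq> pairs0"
    using assms(1) by (auto simp: gen_nice_def)
  then obtain i j k where ijk: "i \<in> fano_points0" "j \<in> fano_points0" "k \<in> fano_points0"
    and T: "{i, j} \<in> T" "{i \<star> j, k} \<in> T"
    and X: "{i, j} \<in> pairs" "{i \<star> j, k} \<in> pairs" and P: "\<not> P_set i j k \<subseteq> T \<inter> pairs"
    using assms(2) unfolding gen_nice_def by blast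
  have "P_set i j k \<subseteq> T"
    using assms(1) ijk T unfolding gen_nice_def by blast
  \<comment> \<open>Some pair of \<open>P_set i j k\<close> is degenerate or contains 0.\<close>
  with P have P': "\<not> P_set i j k \<subseteq> pairs" by blast
  have I: "i \<in> fano_points" "j \<in> fano_points" "k \<in> fano_points" "i \<noteq> j" "k \<noteq> i \<star> j" "i \<star> j \<in> fano_points"
    using X by auto
  have "k = i \<or> k = j"
  proof (rule ccontr)
    assume "\<not> (k = i \<or> k = j)"
    \<comment> \<open>Both restate \<open>k \<noteq> i \<star> j\<close> by cancellation; they
      exclude the degenerate pairs.\<close>
    moreover have "i \<noteq> j \<star> k" "j \<noteq> k \<star> i"
      using I(5) fano_op_cancel ijk by (metis fano_op_commute)+
    ultimately have "P_set i j k \<subseteq> pairs"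
      using I ijk by (auto simp: P_set_def fano_points_iff fano_op_eq_0_iff)
    with P' show False ..
  qed
  then show thesis
    using that [of i j] that [of j i] I T by (auto simp: insert_commute fano_op_commute)
qed

text \<open>The normal form of the witness pair: \<open>5 = 1 \<star> 2\<close>.\<close>
definition flagged :: "nat set set \<Rightarrow> bool" where
  "flagged T \<longleftrightarrow> gen_nice T \<and> {1, 2} \<in> T \<and> {1, 5} \<in> T"

text \<open>The triple \<open>(1, 2, 1)\<close> forces the degenerate pair \<open>{1, 1}\<close>,
  which lies outside \<open>pairs\<close>.\<close>

lemma flagged_inter_pairs_not_nice:
  assumes "flagged T"
  shows "\<not> gen_nice (T \<inter> pairs)"
proof
  assume "gen_nice (T \<inter> pairs)"
  moreover have "{1, 2} \<in> T \<inter> pairs" "{1 \<star> 2, 1} \<in> T \<inter> pairs"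
    using assms by (simp_all add: flagged_def fano_points_iff insert_commute)
  ultimately have "{1, 1} \<in> T \<inter> pairs"
    by (rule gen_niceD(2)) simp_all
  then have "{1, 1} \<in> pairs" by blast
  then show False
    unfolding pair_mem_pairs by blast
qed

section \<open>Structure of flagged sets\<close>

lemma flagged_core:
  assumes "flagged T"
  shows "{0, 0} \<in> T" "{0, 1} \<in> T" "{0, 2} \<in> T" "{1, 1} \<in> T"
proof -
  have T: "gen_nice T" "{1, 2} \<in> T" "{1 \<star> 2, 1} \<in> T"
    using assms by (simp_all add: flagged_def insert_commute)
  \<comment> \<open>The triple \<open>(1, 2, 1)\<close>, with \<open>1 \<star> 2 = 5\<close>, serves
    this claim and the next.\<close>
  show 11: "{1, 1} \<in> T"
    using T by (rule gen_niceD(2)) simp_all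
  have "{2, 1 \<star> 1} \<in> T"
    using T by (rule gen_niceD(4)) simp_all
  then show 02: "{0, 2} \<in> T"
    by (simp add: insert_commute)
  \<comment> \<open>Triple \<open>(2, 0, 1)\<close>: both \<open>{2, 0}\<close> and
    \<open>{2, 1}\<close> are present.\<close>
  show 01: "{0, 1} \<in> T"
    using gen_niceD(1) [OF T(1), of 2 0 1] T 02 by (simp add: insert_commute)
  show "{0, 0} \<in> T"
    using gen_niceD(3) [OF T(1), of 0 1 1] 01 11 by simp
qed

text \<open>Triple \<open>(0, 1, k)\<close> in one direction and \<open>(1, 1, k)\<close> in the
  other, as \<open>{0, 1}\<close> and \<open>{1, 1}\<close> are present.\<close>

lemma flagged_mem_1_iff:
  assumes "flagged T" "k \<in> fano_points0"
  shows "{1, k} \<in> T \<longleftrightarrow> {0, k} \<in> T"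
proof
  have T: "gen_nice T" "{0, 1} \<in> T" "{1, 1} \<in> T"
    using assms flagged_core by (auto simp: flagged_def)
  show "{0, k} \<in> T" if "{1, k} \<in> T"
    using gen_niceD(2) [OF T(1), of 0 1 k] T that assms(2) by (simp add: insert_commute)
  show "{1, k} \<in> T" if "{0, k} \<in> T"
    using gen_niceD(1) [OF T(1), of 1 1 k] T that assms(2) by simp
qed

text \<open>Triple \<open>(0, i, k)\<close>. The set of points joined to 0 thus absorbs each
  neighbour \<open>k\<close> of a member \<open>i\<close>, and the sum
  \<open>i \<star> k\<close>.\<close>

lemma flagged_zero_closed:
  assumes "flagged T" "{i, k} \<in> T" "{0, i} \<in> T" "i \<in> fano_points0" "k \<in> fano_points0"
  shows "{0, k} \<in> T" "{0, i \<star> k} \<in> T"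
  using gen_niceD(2,3) [of T 0 i k] assms by (simp_all add: flagged_def insert_commute)

lemma flagged_zero_shift:
  assumes "flagged T" "{0, k} \<in> T" "k \<in> fano_points0"
  shows "{0, 1 \<star> k} \<in> T"
  using flagged_zero_closed(2) [OF assms(1), of 1 k] flagged_mem_1_iff [OF assms(1,3)]
    flagged_core [OF assms(1)] assms(2,3) by simp

text \<open>The points not joined to \<open>0\<close> lie in one coset of \<open>{0, 1, 2, 5}\<close>, so the sum of two of them
  is joined to \<open>0\<close>.\<close>
lemma flagged_mem_zero:
  assumes "flagged T" "{i, k} \<in> T" "i \<in> fano_points0" "k \<in> fano_points0"
  shows "{0, i} \<in> T"
proof (rule ccontr)
  assume i: "{0, i} \<notin> T"
  have k: "{0, k} \<notin> T"
    using flagged_zero_closed(1) [OF assms(1), of k i] assms i by (auto simp: insert_commute)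
  \<comment> \<open>Triple \<open>(i, k, 0)\<close>: were \<open>i \<star> k\<close> joined to 0,
    \<open>i\<close> would be too.\<close>
  have ik: "{0, i \<star> k} \<notin> T"
    using gen_niceD(2) [of T i k 0] assms i by (auto simp: flagged_def insert_commute)
  have H: "{0, h} \<in> T" if "h \<in> {0, 1, 2, 5}" for h
    using that flagged_core [OF assms(1)] flagged_zero_shift [OF assms(1), of 2] by auto
  have "\<forall>a\<in>fano_points0. \<forall>b\<in>fano_points0. a \<in> {0,1,2,5} \<or> b \<in> {0,1,2,5} \<or> a \<star> b \<in> {0,1,2,5}"
    unfolding fano_points0_eq by simp
  then have "i \<in> {0,1,2,5} \<or> k \<in> {0,1,2,5} \<or> i \<star> k \<in> {0,1,2,5}"
    using assms(3,4) by blast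
  then show False
    using H i k ik by blast
qed

section \<open>Passage to the quotient by \<open>{0, 1}\<close>\<close>

lemma flagged_mem_shift_iff:
  assumes "flagged T" "i \<in> fano_points0" "k \<in> fano_points0"
  shows "{i, 1 \<star> k} \<in> T \<longleftrightarrow> {i, k} \<in> T"
proof -
  \<comment> \<open>From \<open>{i, k}\<close> one gets in turn \<open>{0, i}\<close>,
    \<open>{0, i \<star> k}\<close> and \<open>{1, i \<star> k}\<close>; the triple
    \<open>(i, k, 1)\<close> then shifts \<open>k\<close>.\<close>
  have shift: "{i, 1 \<star> k} \<in> T" if "{i, k} \<in> T" "k \<in> fano_points0" for k
  proof -
    have "{0, i} \<in> T"
      using flagged_mem_zero assms(1,2) that by blast
    then have "{0, i \<star> k} \<in> T"
      using flagged_zero_closed(2) assms(1,2) that by blast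
    then have "{i \<star> k, 1} \<in> T"
      using flagged_mem_1_iff [OF assms(1), of "i \<star> k"] assms(2) that by (simp add: insert_commute)
    then show ?thesis
      using gen_niceD(3) [of T i k 1] assms(1,2) that by (simp add: flagged_def fano_op_commute)
  qed
  \<comment> \<open>Shifting twice is the identity, which gives the converse.\<close>
  show ?thesis
    using shift [of k] shift [of "1 \<star> k"] assms(3) by (auto simp: fano_op_cancel)
qed

text \<open>Least elements of the cosets \<open>{0, 1}\<close>, \<open>{2, 5}\<close>,
  \<open>{3, 6}\<close>, \<open>{4, 7}\<close>, indexed by the point.\<close>

definition coset_rep :: "nat \<Rightarrow> nat" where
  "coset_rep i = [0, 0, 2, 3, 4, 2, 3, 4] ! i"

lemma flagged_mem_coset_rep:
  assumes "flagged T" "i \<in> fano_points0" "j \<in> fano_points0"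
  shows "{i, j} \<in> T \<longleftrightarrow> {coset_rep i, coset_rep j} \<in> T"
proof -
  have reps: "k = coset_rep k \<or> k = 1 \<star> coset_rep k" "coset_rep k \<in> fano_points0"
    if "k \<in> fano_points0" for k
    using that [unfolded fano_points0_eq] by (auto simp: coset_rep_def)
  have right: "{a, k} \<in> T \<longleftrightarrow> {a, coset_rep k} \<in> T"
    if "a \<in> fano_points0" "k \<in> fano_points0" for a k
    using reps [OF that(2)] flagged_mem_shift_iff [OF assms(1) that(1)] by metis
  show ?thesis
    using right [of i j] right [of "coset_rep j" i] assms(2,3) reps(2) by (simp add: insert_commute)
qed

text \<open>\<open>{0, a}\<close> is left out because it will always belong to \<open>T\<close>.\<close>
definition profile :: "nat \<Rightarrow> nat \<Rightarrow> nat \<Rightarrow> nat set set \<Rightarrow> bool list" where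
  "profile a b c T = map (\<lambda>p. p \<in> T)
     [{0, b}, {0, c}, {a, a}, {b, b}, {c, c}, {a, b}, {a, c}, {b, c}]"

text \<open>The representatives 0, 2, 3, 4 form ten pairs. Of these \<open>{0, 0}\<close> and
  \<open>{0, 2}\<close> always occur, and the profile records the other eight.\<close>

lemma flagged_eqI:
  assumes "flagged T" "flagged R" "profile 2 3 4 T = profile 2 3 4 R"
  shows "T = R"
proof (rule pairs0_eqI)
  show "T \<subseteq> pairs0" "R \<subseteq> pairs0"
    using assms by (auto simp: flagged_def gen_nice_def)
  fix i j
  assume ij: "i \<in> fano_points0" "j \<in> fano_points0"
  have "\<forall>a\<in>{0,2,3,4}. \<forall>b\<in>{0,2,3,4}. {a, b} \<in> T \<longleftrightarrow> {a, b} \<in> R"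
    using assms(3) flagged_core [OF assms(1)] flagged_core [OF assms(2)]
    by (simp add: profile_def insert_commute)
  moreover have "coset_rep k \<in> {0,2,3,4}" if "k \<in> fano_points0" for k
    using that [unfolded fano_points0_eq] by (auto simp: coset_rep_def)
  ultimately show "{i, j} \<in> T \<longleftrightarrow> {i, j} \<in> R"
    using flagged_mem_coset_rep [OF assms(1) ij] flagged_mem_coset_rep [OF assms(2) ij] ij by blast
qed

section \<open>The seven representatives\<close>

lemma flagged_reps: "\<forall>R\<in>set nice_reps. flagged R"
proof -
  have I: "{1..7::nat} = {1,2,3,4,5,6,7}"
    by auto
  note nice_simps = flagged_def gen_nice_def P_set_def doubleton_eq_iff
  have "flagged ({{0, 0}} \<union> (\<Union>l\<in>{1,2,5}. {{0, l}, {1, l}}))"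
    unfolding nice_simps fano_points0_eq by (simp add: doubleton_eq_iff)
  moreover have "flagged ({{0, 0}} \<union> (\<Union>l\<in>{1,2,5}. {{0, l}, {1, l}}) \<union> {{2, 2}, {2, 5}, {5, 5}})"
    unfolding nice_simps fano_points0_eq by (simp add: doubleton_eq_iff)
  moreover have "flagged ({{0, 0}} \<union> (\<Union>l\<in>{1,2,5}. {{0, l}, {1, l}}) \<union> {{0, 3}, {0, 6}, {1, 3}, {1, 6}})"
    unfolding nice_simps fano_points0_eq by (simp add: doubleton_eq_iff)
  moreover have "flagged ({{0, 0}} \<union> (\<Union>l\<in>{1..7}. {{0, l}, {1, l}}))"
    unfolding nice_simps fano_points0_eq I by (simp add: doubleton_eq_iff)
  moreover have "flagged ({{0, 0}} \<union> (\<Union>l\<in>{1..7}. {{0, l}, {1, l}}) \<union> {{2, 3}, {5, 3}, {2, 6}, {5, 6}})"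
    unfolding nice_simps fano_points0_eq I by (simp add: doubleton_eq_iff)
  moreover have "flagged (pairs0 - {{k, l} | k l. k \<in> {3,4,6,7} \<and> l \<in> {3,4,6,7}})"
  proof -
    let ?R = "pairs0 - {{k, l} | k l. k \<in> {3,4,6,7} \<and> l \<in> {3,4,6,7}}"
    \<comment> \<open>The removed pairs have both entries outside the subgroup
      \<open>{0, 1, 2, 5}\<close>; put entrywise, niceness is a finite check on points.\<close>
    have mem: "{i, j} \<in> ?R \<longleftrightarrow> i \<in> fano_points0 \<and> j \<in> fano_points0 \<and> \<not> (i \<in> {3,4,6,7} \<and> j \<in> {3,4,6,7})" for i j
      by (simp add: doubleton_eq_iff) blast
    show ?thesis
      unfolding flagged_def gen_nice_def P_set_def insert_subset mem
      unfolding fano_points0_eq by simp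
  qed
  moreover have "flagged pairs0"
    by (simp add: flagged_def gen_nice_def P_set_def)
  ultimately show ?thesis
    by (simp only: nice_reps_def list.set ball_simps simp_thms)
qed

lemma map_card_nice_reps: "map card nice_reps = [7, 10, 11, 15, 19, 26, 36]"
proof -
  have I: "{1..7::nat} = {1,2,3,4,5,6,7}"
    by auto
  let ?K = "{3,4,6,7::nat}"
  let ?D = "{{k, l} | k l. k \<in> ?K \<and> l \<in> ?K}"
  have pairs_eq: "{{k, l} | k l. k \<in> A \<and> l \<in> A} = (\<Union>k\<in>A. (\<lambda>l. {k, l}) ` A)" for A :: "nat set"
    by auto
  have pairs0: "card pairs0 = 36" "finite pairs0"
    unfolding pairs0_def pairs_eq by (simp_all add: fano_points0_eq doubleton_eq_iff card_insert_if)
  have D: "card ?D = 10" "finite ?D"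
    unfolding pairs_eq by (simp_all add: doubleton_eq_iff card_insert_if)
  have "?K \<subseteq> fano_points0"
    by simp
  then have "?D \<subseteq> pairs0"
    unfolding pairs0_def by blast
  with D pairs0 have "card (pairs0 - ?D) = 26"
    by (simp only: card_Diff_subset)
  with pairs0(1) show ?thesis
    unfolding nice_reps_def list.map I
    by (simp only: list.inject simp_thms) (simp add: doubleton_eq_iff card_insert_if)
qed

section \<open>Reduction of flagged sets to the representatives\<close>

lemma flagged_collinear_basis_map:
  assumes T: "flagged T" and R: "flagged R"
    and I0: "v \<in> fano_points0" "w \<in> fano_points0"
    and indep: "v \<notin> {0, 1}" "w \<notin> {0, 1, v, 1 \<star> v}"
    and v: "{0, v} \<in> T" and prof: "profile v w (1 \<star> (v \<star> w)) T = profile 2 3 4 R"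
  shows "collinear_sets T R"
proof -
  \<comment> \<open>This map fixes 1 and sends 2, 3, 4 to \<open>v\<close>, \<open>w\<close>,
    \<open>1 \<star> (v \<star> w)\<close>, so the pullback has at 2, 3, 4 the profile of
    \<open>T\<close> at these points.\<close>
  let ?\<phi> = "basis_map 1 v w"
  have \<phi>: "collineation ?\<phi>"
    using I0 indep by (intro collineation_basis_map) auto
  have "{1, v} \<in> T" "{1, 1 \<star> v} \<in> T"
    using T I0 v flagged_mem_1_iff flagged_mem_shift_iff by simp_all
  then have "flagged (pullback ?\<phi> T)"
    using T \<phi> by (simp add: flagged_def gen_nice_pullback)
  moreover have "profile 2 3 4 (pullback ?\<phi> T) = profile 2 3 4 R"
    unfolding prof [symmetric] by (simp add: profile_def)
  ultimately have "pullback ?\<phi> T = R"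
    using R by (intro flagged_eqI)
  moreover have "T \<subseteq> pairs0"
    using T by (simp add: flagged_def gen_nice_def)
  ultimately show ?thesis
    using collinear_pullback [OF \<phi>] by metis
qed

text \<open>Triple \<open>(i, i, j)\<close> forwards, as \<open>i \<star> i = 0\<close>, and
  \<open>(i, j, i)\<close> backwards.\<close>

lemma flagged_diagonal_iff:
  assumes "flagged T" "{0, j} \<in> T" "{0, i \<star> j} \<in> T" "i \<in> fano_points0" "j \<in> fano_points0"
  shows "{i, i} \<in> T \<longleftrightarrow> {i, j} \<in> T \<and> {i, i \<star> j} \<in> T"
proof
  assume "{i, i} \<in> T"
  then show "{i, j} \<in> T \<and> {i, i \<star> j} \<in> T"
    using gen_niceD(1,3) [of T i i j] assms by (simp add: flagged_def)
next
  assume "{i, j} \<in> T \<and> {i, i \<star> j} \<in> T"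
  then show "{i, i} \<in> T"
    using gen_niceD(2) [of T i j i] assms by (simp add: flagged_def insert_commute)
qed

text \<open>Constraints on the profile, in propositional form for the case analysis. An edge between
  nonzero classes puts its ends and their sum among the points joined to 0; a class with a loop is
  joined to every such point; if 3 and 4 are both joined to 0, edges determine loops.\<close>

lemma flagged_relations:
  assumes "flagged T"
  shows "{2, 3} \<in> T \<or> {2, 4} \<in> T \<or> {3, 4} \<in> T \<longrightarrow> {0, 3} \<in> T \<and> {0, 4} \<in> T"
    and "{3, 3} \<in> T \<longrightarrow> {0, 3} \<in> T \<and> {2, 3} \<in> T"
    and "{4, 4} \<in> T \<longrightarrow> {0, 4} \<in> T \<and> {2, 4} \<in> T"
    and "{0, 3} \<in> T \<longrightarrow> {2, 2} \<in> T \<longrightarrow> {2, 3} \<in> T"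
    and "{0, 4} \<in> T \<longrightarrow> {2, 2} \<in> T \<longrightarrow> {2, 4} \<in> T"
    and "{0, 3} \<in> T \<longrightarrow> {0, 4} \<in> T \<longrightarrow> {2, 2} \<in> T \<longleftrightarrow> {2, 3} \<in> T \<and> {2, 4} \<in> T"
    and "{0, 3} \<in> T \<longrightarrow> {0, 4} \<in> T \<longrightarrow> {3, 3} \<in> T \<longleftrightarrow> {2, 3} \<in> T \<and> {3, 4} \<in> T"
    and "{0, 3} \<in> T \<longrightarrow> {0, 4} \<in> T \<longrightarrow> {4, 4} \<in> T \<longleftrightarrow> {2, 4} \<in> T \<and> {3, 4} \<in> T"
proof -
  note shift = flagged_mem_shift_iff [OF assms]
  \<comment> \<open>Sums such as \<open>2 \<star> 3 = 7\<close> are brought back to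
    representatives.\<close>
  note shifts = shift [of 0 3, simplified] shift [of 0 4, simplified] shift [of 2 4, simplified]
    shift [of 3 4, simplified] shift [of 4 3, simplified]
  note diag = flagged_diagonal_iff [OF assms]
  note zero = flagged_mem_zero [OF assms]
  note 02 = flagged_core(3) [OF assms]
  have diag_mem: "{i, j} \<in> T"
    if "{i, i} \<in> T" "{0, j} \<in> T" "i \<in> fano_points0" "j \<in> fano_points0" for i j
    using gen_niceD(1) [of T i i j] assms that by (simp add: flagged_def)
  show "{2, 3} \<in> T \<or> {2, 4} \<in> T \<or> {3, 4} \<in> T \<longrightarrow> {0, 3} \<in> T \<and> {0, 4} \<in> T"
    using zero [of 3 2] zero [of 3 4] zero [of 4 2] zero [of 4 3] shifts
      flagged_zero_closed(2) [OF assms, of 2 3] flagged_zero_closed(2) [OF assms, of 2 4] 02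
    by (auto simp: insert_commute)
  show "{3, 3} \<in> T \<longrightarrow> {0, 3} \<in> T \<and> {2, 3} \<in> T"
    using zero [of 3 3] diag_mem [of 3 2] 02 by (simp add: insert_commute)
  show "{4, 4} \<in> T \<longrightarrow> {0, 4} \<in> T \<and> {2, 4} \<in> T"
    using zero [of 4 4] diag_mem [of 4 2] 02 by (simp add: insert_commute)
  show "{0, 3} \<in> T \<longrightarrow> {2, 2} \<in> T \<longrightarrow> {2, 3} \<in> T"
    using diag_mem [of 2 3] by simp
  show "{0, 4} \<in> T \<longrightarrow> {2, 2} \<in> T \<longrightarrow> {2, 4} \<in> T"
    using diag_mem [of 2 4] by simp
  \<comment> \<open>The variables of \<open>diag\<close> come in the order \<open>j\<close>,
    \<open>i\<close>: here \<open>i = 2\<close> and \<open>j = 3\<close>.\<close>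
  show "{0, 3} \<in> T \<longrightarrow> {0, 4} \<in> T \<longrightarrow> {2, 2} \<in> T \<longleftrightarrow> {2, 3} \<in> T \<and> {2, 4} \<in> T"
    using diag [of 3 2] shifts by (simp add: insert_commute)
  show "{0, 3} \<in> T \<longrightarrow> {0, 4} \<in> T \<longrightarrow> {3, 3} \<in> T \<longleftrightarrow> {2, 3} \<in> T \<and> {3, 4} \<in> T"
    using diag [of 2 3] shifts 02 by (simp add: insert_commute)
  show "{0, 3} \<in> T \<longrightarrow> {0, 4} \<in> T \<longrightarrow> {4, 4} \<in> T \<longleftrightarrow> {2, 4} \<in> T \<and> {3, 4} \<in> T"
    using diag [of 2 4] shifts 02 by (simp add: insert_commute)
qed

lemma profile_nice_reps:
  "map (profile 2 3 4) nice_reps =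
    [[False, False, False, False, False, False, False, False],
     [False, False, True, False, False, False, False, False],
     [True, False, False, False, False, False, False, False],
     [True, True, False, False, False, False, False, False],
     [True, True, False, False, False, True, False, False],
     [True, True, True, False, False, True, True, False],
     [True, True, True, True, True, True, True, True]]"
proof -
  have I: "{1..7::nat} = {1,2,3,4,5,6,7}"
    by auto
  show ?thesis
    unfolding nice_reps_def I by (auto simp: profile_def doubleton_eq_iff)
qed

lemma flagged_collinear_rep:
  assumes "flagged T"
  shows "\<exists>n < length nice_reps. collinear_sets T (nice_reps ! n)"
proof -
  \<comment> \<open>Each entry is \<open>(v, w, 1 \<star> (v \<star> w))\<close> and permutes the
    classes of 2, 3, 4. The point \<open>v\<close> must be joined to 0, as it takes the place of
    2.\<close>
  let ?bases = "{(2, 3, 4), (2, 4, 3), (3, 4, 2), (3, 2, 4), (4, 3, 2)}"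
  define a3 a4 where zero_defs: "a3 \<longleftrightarrow> {0, 3} \<in> T" "a4 \<longleftrightarrow> {0, 4} \<in> T"
  define s22 s33 s44 where diag_defs: "s22 \<longleftrightarrow> {2, 2} \<in> T" "s33 \<longleftrightarrow> {3, 3} \<in> T" "s44 \<longleftrightarrow> {4, 4} \<in> T"
  define s23 s24 s34 where off_defs: "s23 \<longleftrightarrow> {2, 3} \<in> T" "s24 \<longleftrightarrow> {2, 4} \<in> T" "s34 \<longleftrightarrow> {3, 4} \<in> T"
  note rel = flagged_relations [OF assms, folded zero_defs diag_defs off_defs]
  have profiles: "profile 2 3 4 T = [a3, a4, s22, s33, s44, s23, s24, s34]"
    "profile 2 4 3 T = [a4, a3, s22, s44, s33, s24, s23, s34]"
    "profile 3 4 2 T = [a4, True, s33, s44, s22, s34, s23, s24]"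
    "profile 3 2 4 T = [True, a4, s33, s22, s44, s23, s34, s24]"
    "profile 4 3 2 T = [a3, True, s44, s33, s22, s34, s24, s23]"
    using flagged_core(3) [OF assms]
    by (simp_all add: profile_def zero_defs diag_defs off_defs insert_commute)
  have "\<exists>(v, w, x) \<in> ?bases. {0, v} \<in> T \<and> profile v w x T \<in> set (map (profile 2 3 4) nice_reps)"
    unfolding profile_nice_reps
    by (simp add: profiles zero_defs [symmetric] flagged_core(3) [OF assms]) (use rel in satx)
  then obtain v w x where vwx: "(v, w, x) \<in> ?bases" and v: "{0, v} \<in> T"
    and "profile v w x T \<in> set (map (profile 2 3 4) nice_reps)"
    unfolding Bex_def split_paired_Ex prod.case by blast
  then obtain R where R: "R \<in> set nice_reps" and prof: "profile v w x T = profile 2 3 4 R"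
    unfolding set_map by blast
  have "collinear_sets T R"
    using assms
  proof (rule flagged_collinear_basis_map)
    show "flagged R"
      using R flagged_reps by blast
    show "profile v w (1 \<star> (v \<star> w)) T = profile 2 3 4 R"
      using vwx prof by auto
  qed (use vwx v in auto)
  with R show ?thesis
    by (metis in_set_conv_nth)
qed

section \<open>Normalisation of arbitrary sets and the count of classes\<close>

lemma collinear_flagged:
  assumes "gen_nice T" "\<not> gen_nice (T \<inter> pairs)"
  obtains U where "collinear_sets T U" "flagged U"
proof -
  obtain i j where ij: "i \<in> fano_points" "j \<in> fano_points" "i \<noteq> j" "{i, j} \<in> T" "{i, i \<star> j} \<in> T"
    using not_nice_witness [OF assms] .
  \<comment> \<open>The span of \<open>i\<close> and \<open>j\<close> has at most four of the eight
    points, so a third basis vector \<open>w\<close> exists.\<close>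
  have "card {0, i, j, i \<star> j} \<le> 4"
    by (simp add: card_insert_if)
  moreover have "card fano_points0 = 8"
    by (simp add: fano_points0_eq)
  ultimately have "\<not> fano_points0 \<subseteq> {0, i, j, i \<star> j}"
    using card_mono [of "{0, i, j, i \<star> j}" fano_points0] by auto
  then obtain w where w: "w \<in> fano_points0" "w \<notin> {0, i, j, i \<star> j}"
    by blast
  have \<phi>: "collineation (basis_map i j w)"
    using ij w by (intro collineation_basis_map) (auto simp: fano_points_iff)
  show thesis
  proof
    show "collinear_sets T (pullback (basis_map i j w) T)"
      using \<phi> assms(1) by (intro collinear_pullback) (auto simp: gen_nice_def)
    show "flagged (pullback (basis_map i j w) T)"
      using \<phi> assms(1) ij by (simp add: flagged_def gen_nice_pullback)
  qed
qed

theorem theorem5p8: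
  shows "card ({T. gen_nice T \<and> \<not> gen_nice (T \<inter> pairs)} // {(T, T'). collinear_sets T T'}) = 7 \<and>
    length nice_reps = 7 \<and>
    map card nice_reps = [7, 10, 11, 15, 19, 26, 36] \<and>
    (\<forall>R\<in>set nice_reps. gen_nice R \<and> \<not> gen_nice (R \<inter> pairs)) \<and>
    (\<forall>T. gen_nice T \<and> \<not> gen_nice (T \<inter> pairs) \<longrightarrow>
       (\<exists>!n. n < length nice_reps \<and> collinear_sets T (nice_reps ! n)))"
proof -
  let ?B = "{T. gen_nice T \<and> \<not> gen_nice (T \<inter> pairs)}"
  let ?r = "{(T, T'). collinear_sets T T'}"
  have len: "length nice_reps = 7"
    by (simp add: nice_reps_def)
  have dist: "distinct (map card nice_reps)"
    unfolding map_card_nice_reps by simp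
  have reps: "\<forall>R\<in>set nice_reps. gen_nice R \<and> \<not> gen_nice (R \<inter> pairs)"
    using flagged_reps flagged_inter_pairs_not_nice by (auto simp: flagged_def)
  have ex: "\<exists>n < length nice_reps. collinear_sets T (nice_reps ! n)" if T: "T \<in> ?B" for T
  proof -
    obtain U where "collinear_sets T U" "flagged U"
      using T collinear_flagged by blast
    with flagged_collinear_rep show ?thesis
      using collinear_sets_trans by blast
  qed
  \<comment> \<open>The seven cardinalities are distinct.\<close>
  have reps_eq: "R = R'"
    if "R \<in> set nice_reps" "R' \<in> set nice_reps" "collinear_sets R R'" for R R'
    using collinear_sets_card [OF that(3)] dist that(1,2)
    by (auto simp: distinct_map dest: inj_onD)
  have unique: "\<exists>!n. n < length nice_reps \<and> collinear_sets T (nice_reps ! n)" if "T \<in> ?B" for T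
  proof (rule ex_ex1I)
    show "\<exists>n. n < length nice_reps \<and> collinear_sets T (nice_reps ! n)"
      using ex [OF that] by blast
    show "m = n" if mn: "m < length nice_reps \<and> collinear_sets T (nice_reps ! m)"
      "n < length nice_reps \<and> collinear_sets T (nice_reps ! n)" for m n
    proof -
      have "nice_reps ! m = nice_reps ! n"
        using mn reps_eq collinear_sets_sym collinear_sets_trans nth_mem by meson
      then show ?thesis
        using mn dist by (simp add: distinct_map nth_eq_iff_index_eq)
    qed
  qed
  \<comment> \<open>Symmetry and transitivity suffice; reflexivity holds only for subsets of
    \<open>pairs0\<close>.\<close>
  have class_eq: "?r `` {T} = ?r `` {R}" if "collinear_sets T R" for T R
    using collinear_sets_trans [OF that] collinear_sets_trans [OF collinear_sets_sym [OF that]] by auto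
  have "?B // ?r = (\<lambda>R. ?r `` {R}) ` set nice_reps"
  proof
    show "?B // ?r \<subseteq> (\<lambda>R. ?r `` {R}) ` set nice_reps"
    proof
      fix C
      assume "C \<in> ?B // ?r"
      then obtain T where T: "T \<in> ?B" "C = ?r `` {T}"
        by (rule quotientE)
      with ex obtain n where "n < length nice_reps" "collinear_sets T (nice_reps ! n)"
        by blast
      with T(2) class_eq show "C \<in> (\<lambda>R. ?r `` {R}) ` set nice_reps"
        using nth_mem by (metis image_eqI)
    qed
    show "(\<lambda>R. ?r `` {R}) ` set nice_reps \<subseteq> ?B // ?r"
    proof (rule image_subsetI)
      show "?r `` {R} \<in> ?B // ?r" if "R \<in> set nice_reps" for R
        using that reps by (intro quotientI) blast
    qed
  qed
  moreover have "inj_on (\<lambda>R. ?r `` {R}) (set nice_reps)"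
  proof (rule inj_onI)
    fix R R'
    assume R: "R \<in> set nice_reps" "R' \<in> set nice_reps" "?r `` {R} = ?r `` {R'}"
    have "collinear_sets R' R'"
      using R(2) reps by (intro collinear_sets_refl) (auto simp: gen_nice_def)
    then have "R' \<in> ?r `` {R}"
      unfolding R(3) by simp
    then show "R = R'"
      using R(1,2) reps_eq by simp
  qed
  moreover have "card (set nice_reps) = 7"
    using dist len by (simp add: distinct_map distinct_card)
  ultimately have "card (?B // ?r) = 7"
    by (simp add: card_image)
  with len map_card_nice_reps reps unique show ?thesis
    by blast
qed

end
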